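(* Let $X,Y$ be metric spaces, and let $F:X\rightrightarrows Y$, $(\bar x,\bar y)\in\operatorname{gph}F$ and $\varphi:\mathbb R_+\to\mathbb R_+$ be as in the context. (i) ${}^sr_\varphi[F](\bar x,\bar y)\le\overline{|\nabla F|}{}^{\diamond}_\varphi(\bar x,\bar y)$. (ii) If $X$ and $Y$ are complete and $\operatorname{gph}F$ is locally closed near $(\bar x,\bar y)$, then ${}^sr_\varphi[F](\bar x,\bar y)=\overline{|\nabla F|}{}^{\diamond}_\varphi(\bar x,\bar y)$.
   Context: $F:X\rightrightarrows Y$ is a set-valued mapping between metric spaces, $\operatorname{gph}F=\{(x,y): y\in F(x)\}$, $F^{-1}(y)=\{x: y\in F(x)\}$, $(\bar x,\bar y)\in\operatorname{gph}F$. A set $\Omega$ is locally closed near $\bar z\in\Omega$ iff $\Omega\cap U$ is closed for some closed neighbourhood $U$ of $\bar z$. $\varphi:\mathbb R_+\to\mathbb R_+$ ($\mathbb R_+=[0,\infty)$) is continuously differentiable, with possibly infinite $\varphi'(0)$ understood as the right-hand derivative, $\varphi(0)=0$ and $\varphi'(t)>0$ for all $t\in\mathbb R_+$. The modulus of metric $\varphi$-subregularity is $${}^sr_\varphi[F](\bar x,\bar y)=\liminf_{x\to\bar x,\ x\notin F^{-1}(\bar y)}\frac{\varphi(d(\bar y,F(x)))}{d(x,F^{-1}(\bar y))}=\liminf_{x\to\bar x,\ x\notin F^{-1}(\bar y),\ y\in F(x)}\frac{\varphi(d(y,\bar y))}{d(x,F^{-1}(\bar y))}$$ (with $a/0=+\infty$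 for $a>0$, the infimum over the empty set equal to $+\infty$, and points $x$ with $F(x)=\emptyset$ not contributing); it is the supremum of all $\tau>0$ such that, for some neighbourhood $U$ of $\bar x$, $\tau d(x,F^{-1}(\bar y))\le\varphi(d(y,\bar y))$ for all $x\in U$, $y\in F(x)$ (understood as $0$ if there is no such $\tau$). For $\rho>0$ and $(x,y)\in\operatorname{gph}F$, with $d_\rho((x,y),(u,v))=\max\{d(x,u),\rho\,d(y,v)\}$, $$|\nabla F|^{\diamond}_{\varphi,\rho}(x,y)=\sup_{(u,v)\ne(x,y),\,(u,v)\in\operatorname{gph}F}\frac{\varphi(d(y,\bar y))-\varphi(d(v,\bar y))}{d_\rho((u,v),(x,y))},$$ and $\overline{|\nabla F|}{}^{\diamond}_\varphi(\bar x,\bar y)=\lim_{\rho\downarrow0}\inf\{|\nabla F|^{\diamond}_{\varphi,\rho}(x,y): (x,y)\in\operatorname{gph}F,\ d(x,\bar x)<\rho,\ d(y,\bar y)<\rho,\ x\notin F^{-1}(\bar y)\}$. *)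

theory Defs
  imports "HOL-Analysis.Analysis"
begin

text \<open>A set-valued mapping from a metric space into another is a function \<open>F :: 'a \<Rightarrow> 'b set\<close>.\<close>

definition gph :: "('a \<Rightarrow> 'b set) \<Rightarrow> ('a \<times> 'b) set"
  where "gph F = {(x, y). y \<in> F x}"

definition inv_map :: "('a \<Rightarrow> 'b set) \<Rightarrow> 'b \<Rightarrow> 'a set"
  where "inv_map F y = {x. y \<in> F x}"

definition locally_closed_near :: "'a::topological_space set \<Rightarrow> 'a \<Rightarrow> bool"
  where "locally_closed_near \<Omega> z \<longleftrightarrow>
    (\<exists>U. closed U \<and> z \<in> interior U \<and> closed (\<Omega> \<inter> U))"

text \<open>
  Only the values of \<open>\<phi>\<close> on \<open>[0,\<infinity>)\<close> matter. The derivative \<open>\<phi>'\<close> is a continuous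
  function from \<open>[0,\<infinity>)\<close> to the extended reals which may be infinite only at 0. Since an
  infinite right-hand derivative at 0 does not imply continuity at 0, the continuity of
  \<open>\<phi>\<close> is required separately.
\<close>

definition admissible :: "(real \<Rightarrow> real) \<Rightarrow> bool"
  where "admissible \<phi> \<longleftrightarrow>
    (\<forall>t\<ge>0. 0 \<le> \<phi> t) \<and> \<phi> 0 = 0 \<and> continuous_on {0..} \<phi> \<and>
    (\<exists>\<phi>' :: real \<Rightarrow> ereal.
       continuous_on {0..} \<phi>' \<and>
       (\<forall>t\<ge>0. 0 < \<phi>' t) \<and>
       (\<forall>t>0. \<phi>' t \<noteq> \<infinity> \<and> (\<phi> has_real_derivative real_of_ereal (\<phi>' t)) (at t)) \<and>
       ((\<lambda>t. ereal ((\<phi> t - \<phi> 0) / t)) \<longlongrightarrow> \<phi>' 0) (at_right 0))"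

text \<open>
  The modulus of metric \<open>\<phi>\<close>-subregularity is the lower limit over pairs \<open>(x, y)\<close> with
  \<open>y \<in> F x\<close> and \<open>ybar \<notin> F x\<close> as \<open>x \<rightarrow> xbar\<close>, with no restriction on the distance of
  \<open>y\<close> from \<open>ybar\<close>. As \<open>y \<noteq> ybar\<close> for such pairs, the numerator is positive, and
  division in \<^typ>\<open>ereal\<close> gives \<open>a / 0 = \<infinity>\<close>. The function \<^const>\<open>infdist\<close> is the usual distance
  to a set when the set is nonempty, which is the case here if \<open>ybar \<in> F xbar\<close>.
\<close>

definition subreg_modulus ::
    "(real \<Rightarrow> real) \<Rightarrow> ('a::metric_space \<Rightarrow> 'b::metric_space set) \<Rightarrow> 'a \<Rightarrow> 'b \<Rightarrow> ereal"
  where "subreg_modulus \<phi> F xbar ybar =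
    Liminf (inf (filtercomap fst (nhds xbar))
                (principal {(x, y). x \<notin> inv_map F ybar \<and> y \<in> F x}))
      (\<lambda>(x, y). ereal (\<phi> (dist y ybar)) / ereal (infdist x (inv_map F ybar)))"

definition dist_rho :: "real \<Rightarrow> 'a::metric_space \<times> 'b::metric_space \<Rightarrow> 'a \<times> 'b \<Rightarrow> real"
  where "dist_rho \<rho> p q = max (dist (fst p) (fst q)) (\<rho> * dist (snd p) (snd q))"

definition nonlocal_slope ::
    "(real \<Rightarrow> real) \<Rightarrow> real \<Rightarrow> ('a::metric_space \<Rightarrow> 'b::metric_space set) \<Rightarrow> 'b \<Rightarrow> 'a \<Rightarrow> 'b \<Rightarrow> ereal"
  where "nonlocal_slope \<phi> \<rho> F ybar x y =
    (SUP (u, v) \<in> {(u, v). (u, v) \<noteq> (x, y) \<and> (u, v) \<in> gph F}.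
       ereal ((\<phi> (dist y ybar) - \<phi> (dist v ybar)) / dist_rho \<rho> (u, v) (x, y)))"

text \<open>
  If \<open>\<phi>\<close> is admissible and \<open>(xbar, ybar) \<in> gph F\<close>, the infimum below is nonincreasing in
  \<open>\<rho> > 0\<close> (each supremum involved is positive, by the choice \<open>(u, v) = (xbar, ybar)\<close>), so its limit as
  \<open>\<rho> \<down> 0\<close> exists in \<^typ>\<open>ereal\<close>.
\<close>

definition slope_inf ::
    "(real \<Rightarrow> real) \<Rightarrow> real \<Rightarrow> ('a::metric_space \<Rightarrow> 'b::metric_space set) \<Rightarrow> 'a \<Rightarrow> 'b \<Rightarrow> ereal"
  where "slope_inf \<phi> \<rho> F xbar ybar =
    (INF (x, y) \<in> {(x, y). (x, y) \<in> gph F \<and> dist x xbar < \<rho> \<and> dist y ybar < \<rho> \<and>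
                           x \<notin> inv_map F ybar}.
       nonlocal_slope \<phi> \<rho> F ybar x y)"

definition uniform_strict_slope ::
    "(real \<Rightarrow> real) \<Rightarrow> ('a::metric_space \<Rightarrow> 'b::metric_space set) \<Rightarrow> 'a \<Rightarrow> 'b \<Rightarrow> ereal"
  where "uniform_strict_slope \<phi> F xbar ybar =
    Lim (at_right 0) (\<lambda>\<rho>. slope_inf \<phi> \<rho> F xbar ybar)"

end

theory Submission
  imports Defs
begin

text \<open>
  For the first part, near points \<open>u\<close> of \<open>F\<^sup>-\<^sup>1(ybar)\<close> give competitors \<open>(u, ybar)\<close> in the supremum
  defining the slope at \<open>(x, y)\<close>; the term \<open>\<rho> d(y, ybar)\<close> in the denominator is harmless because
  \<open>\<phi>(t)/t\<close> stays away from 0 as \<open>t \<down> 0\<close>. For the second part, a point \<open>(x, y)\<close> of the graph near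
  \<open>(xbar, ybar)\<close> with \<open>\<phi>(d(y, ybar)) < \<tau> d(x, F\<^sup>-\<^sup>1(ybar))\<close> is moved by Ekeland's variational
  principle, applied to \<open>(u, v) \<mapsto> \<phi>(d(v, ybar))\<close> with the metric \<open>\<tau> d\<^sub>\<rho>\<close>, to a point still outside
  \<open>F\<^sup>-\<^sup>1(ybar)\<close> at which the slope is at most \<open>\<tau>\<close>.
\<close>

section \<open>Ekeland's variational principle on a complete set\<close>

text \<open>Greedy descent: each \<open>s (Suc n)\<close> nearly minimizes \<open>f\<close> over the
  set \<open>S (s n)\<close> of points that pay for their \<open>d\<close>-distance from
  \<open>s n\<close> by a decrease of \<open>f\<close>. As \<open>f\<close> is bounded below, these
  distances shrink, and the limit of \<open>s\<close> is the required point. No symmetry of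
  \<open>d\<close> is assumed, so the order of its arguments matters: the new point comes first. The
  bound by \<open>c * dist\<close> transfers Cauchy sequences and separation of points to
  \<open>d\<close>.\<close>

lemma ekeland_variational_principle:
  fixes A :: "'a::metric_space set" and f :: "'a \<Rightarrow> real" and d :: "'a \<Rightarrow> 'a \<Rightarrow> real"
  assumes "complete A" and "a \<in> A"
    and cont_f: "continuous_on A f" and bdd: "\<And>x. x \<in> A \<Longrightarrow> B \<le> f x"
    and d_refl: "\<And>x. d x x = 0"
    and triangle: "\<And>x y z. d z x \<le> d z y + d y x"
    and cont_d: "\<And>x. continuous_on A (\<lambda>z. d z x)"
    and c: "0 < c" "\<And>x y. c * dist x y \<le> d x y"
  obtains x where "x \<in> A" and "f x + d x a \<le> f a"
    and "\<And>z. z \<in> A \<Longrightarrow> z \<noteq> x \<Longrightarrow> f x < f z + d z x"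
proof -
  define S where "S x = {z \<in> A. f z + d z x \<le> f x}" for x
  have S_refl: "x \<in> S x" if "x \<in> A" for x
    using that by (simp add: S_def d_refl)
  have S_trans: "S y \<subseteq> S x" if "y \<in> S x" for x y
  proof
    fix z assume "z \<in> S y"
    with that triangle[of z x y] show "z \<in> S x"
      by (auto simp: S_def)
  qed
  have "\<exists>y. y \<in> S x \<and> (\<forall>z\<in>S x. f y < f z + e)" if "x \<in> A" "0 < e" for x e
  proof -
    have bb: "bdd_below (f ` S x)"
      using bdd by (auto simp: S_def intro!: bdd_belowI[of _ B])
    have "\<exists>v \<in> f ` S x. v < Inf (f ` S x) + e"
      using S_refl[OF \<open>x \<in> A\<close>] \<open>0 < e\<close> by (subst cInf_less_iff[symmetric]) (auto simp: bb)
    then show ?thesis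
      using cINF_lower[OF bb] by fastforce
  qed
  then have "\<exists>y. y \<in> A \<and> y \<in> S x \<and> (\<forall>z\<in>S x. f y < f z + inverse (real (Suc n)))"
    if "x \<in> A" for x n
    using that by (fastforce simp: S_def)
  then obtain s where s0: "s 0 = a" and sA: "\<And>n. s n \<in> A"
    and s: "\<And>n. s (Suc n) \<in> S (s n)"
      "\<And>n z. z \<in> S (s n) \<Longrightarrow> f (s (Suc n)) < f z + inverse (real (Suc n))"
    using dependent_nat_choice[of "\<lambda>n x. x \<in> A \<and> (n = 0 \<longrightarrow> x = a)"
        "\<lambda>n x y. y \<in> S x \<and> (\<forall>z\<in>S x. f y < f z + inverse (real (Suc n)))"] \<open>a \<in> A\<close>
    by (metis nat.distinct(1))
  have sS: "s m \<in> S (s n)" if "n \<le> m" for m n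
    using that
  proof (induction m rule: dec_induct)
    case base
    show ?case using S_refl sA by blast
  next
    case (step m)
    with s(1) S_trans show ?case by blast
  qed
  have d_s: "d (s m) (s n) \<le> f (s n) - f (s m)" if "n \<le> m" for m n
    using sS[OF that] by (simp add: S_def)
  have d_nonneg: "0 \<le> d x y" for x y
    using c(2)[of x y] c(1) by (smt (verit) mult_nonneg_nonneg zero_le_dist)
  have "decseq (\<lambda>n. f (s n))"
    using d_s d_nonneg by (intro decseq_SucI) (smt (verit) Suc_n_not_le_n nat_le_linear)
  then have "convergent (\<lambda>n. f (s n))"
    using decseq_convergent[of "\<lambda>n. f (s n)" B] bdd sA by (metis convergentI)
  then have Cf: "Cauchy (\<lambda>n. f (s n))"
    by (rule convergent_Cauchy)
  \<comment> \<open>Distances along \<open>s\<close> are at most 1 / \<open>c\<close> times the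
    decrease of \<open>f\<close>, and the values of \<open>f\<close> converge.\<close>
  have "Cauchy s"
    unfolding Cauchy_altdef
  proof (intro allI impI)
    fix e :: real assume "0 < e"
    with c(1) have "0 < c * e" by simp
    then obtain M where M: "\<And>m n. M \<le> m \<Longrightarrow> m < n \<Longrightarrow> dist (f (s m)) (f (s n)) < c * e"
      using Cf unfolding Cauchy_altdef by meson
    have "dist (s m) (s n) < e" if "M \<le> m" "m < n" for m n
    proof -
      have "c * dist (s n) (s m) < c * e"
        using c(2)[of "s n" "s m"] d_s[of m n] M[OF that] that by (auto simp: dist_real_def)
      with c(1) show ?thesis by (simp add: dist_commute)
    qed
    then show "\<exists>M. \<forall>m\<ge>M. \<forall>n>m. dist (s m) (s n) < e" by blast
  qed
  then obtain x where x: "x \<in> A" "s \<longlonglongrightarrow> x"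
    using \<open>complete A\<close> sA unfolding complete_def by blast
  have lim: "(\<lambda>m. g (s m)) \<longlonglongrightarrow> g x" if "continuous_on A g" for g :: "'a \<Rightarrow> real"
    using that x sA unfolding continuous_on_sequentially o_def by blast
  \<comment> \<open>The inequality defining \<open>S (s n)\<close> holds along the whole tail of
    \<open>s\<close> and passes to the limit by continuity.\<close>
  have xS: "x \<in> S (s n)" for n
  proof -
    have "(\<lambda>m. f (s m) + d (s m) (s n)) \<longlonglongrightarrow> f x + d x (s n)"
      by (intro tendsto_add lim cont_f cont_d)
    moreover have "\<forall>m\<ge>n. f (s m) + d (s m) (s n) \<le> f (s n)"
      using d_s by (simp add: le_diff_eq add.commute)
    ultimately show ?thesis
      using x(1) by (auto simp: S_def intro: LIMSEQ_le_const2)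
  qed
  show thesis
  proof
    show "x \<in> A" by fact
    show "f x + d x a \<le> f a"
      using xS[of 0] s0 by (simp add: S_def)
    fix z assume z: "z \<in> A" "z \<noteq> x"
    show "f x < f z + d z x"
    proof (rule ccontr)
      assume "\<not> ?thesis"
      with z have zS: "z \<in> S x" by (simp add: S_def)
      \<comment> \<open>A violating \<open>z\<close> lies in every \<open>S (s n)\<close> by
        transitivity, so it competed in each near-minimization. In the limit \<open>f x\<close> is
        at most \<open>f z\<close>, which leaves no room for a positive
        \<open>d z x\<close>.\<close>
      then have le: "f (s (Suc n)) \<le> f z + inverse (real (Suc n))" for n
        using s(2) S_trans[OF xS] by (meson less_imp_le subsetD)
      have "(\<lambda>n. f z + inverse (real (Suc n))) \<longlonglongrightarrow> f z + 0"
        by (intro tendsto_add tendsto_const LIMSEQ_inverse_real_of_nat)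
      with LIMSEQ_Suc[OF lim[OF cont_f]] have "f x \<le> f z + 0"
        by (rule LIMSEQ_le) (use le in blast)
      with zS have "d z x \<le> 0" by (simp add: S_def)
      moreover have "0 < c * dist z x"
        using c(1) z by simp
      ultimately show False
        using c(2)[of z x] by linarith
    qed
  qed
qed

section \<open>Growth of admissible functions\<close>

text \<open>A positive finite derivative is available on the open interval only; continuity covers
  the endpoint 0, where the derivative may be infinite.\<close>

lemma admissible_strict_mono:
  assumes "admissible \<phi>" and "0 \<le> s" and "s < t"
  shows "\<phi> s < \<phi> t"
proof -
  from assms(1) obtain \<phi>' :: "real \<Rightarrow> ereal" where cont: "continuous_on {0..} \<phi>"
    and pos: "\<And>t. 0 \<le> t \<Longrightarrow> 0 < \<phi>' t"
    and der: "\<And>t. 0 < t \<Longrightarrow> \<phi>' t \<noteq> \<infinity> \<and> (\<phi> has_real_derivative real_of_ereal (\<phi>' t)) (at t)"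
    unfolding admissible_def by blast
  show ?thesis
  proof (rule DERIV_pos_imp_increasing_open[OF assms(3)])
    fix x assume "s < x" "x < t"
    with assms(2) have "0 < x" by simp
    with der[of x] pos[of x] show "\<exists>y. DERIV \<phi> x :> y \<and> 0 < y"
      by (auto simp: zero_less_real_of_ereal intro!: exI[of _ "real_of_ereal (\<phi>' x)"])
  next
    show "continuous_on {s..t} \<phi>"
      using cont by (rule continuous_on_subset) (use assms in auto)
  qed
qed

lemma admissible_pos:
  assumes "admissible \<phi>" and "0 < t"
  shows "0 < \<phi> t"
  using admissible_strict_mono[OF assms(1), of 0 t] assms by (simp add: admissible_def)

text \<open>The quotients \<phi>(t)/t tend to a positive, possibly infinite limit, so any real
  \<open>c\<close> strictly between 0 and that limit works.\<close>

lemma admissible_linear_lower_bound: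
  assumes "admissible \<phi>"
  obtains c \<delta> where "0 < c" "0 < \<delta>" "\<And>t. 0 < t \<Longrightarrow> t < \<delta> \<Longrightarrow> c * t < \<phi> t"
proof -
  from assms obtain \<phi>' :: "real \<Rightarrow> ereal" where "\<phi> 0 = 0" "0 < \<phi>' 0"
    and lim: "((\<lambda>t. ereal ((\<phi> t - \<phi> 0) / t)) \<longlongrightarrow> \<phi>' 0) (at_right 0)"
    unfolding admissible_def by auto
  obtain c where c: "0 < ereal c" "ereal c < \<phi>' 0"
    using ereal_dense2[OF \<open>0 < \<phi>' 0\<close>] by blast
  have "eventually (\<lambda>t. ereal c < ereal ((\<phi> t - \<phi> 0) / t)) (at_right 0)"
    using order_tendstoD(1)[OF lim c(2)] .
  then obtain \<delta> where "0 < \<delta>" "\<And>t. 0 < t \<Longrightarrow> t < \<delta> \<Longrightarrow> c < \<phi> t / t"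
    unfolding eventually_at_right_field using \<open>\<phi> 0 = 0\<close> by auto
  with c(1) show thesis
    by (intro that[of c \<delta>]) (auto simp: pos_less_divide_eq)
qed

section \<open>The subregularity modulus in terms of real inequalities\<close>

lemma eventually_filtercomap_fst_principal:
  fixes a :: "'a::metric_space"
  shows "eventually P (inf (filtercomap fst (nhds a)) (principal A)) \<longleftrightarrow>
    (\<exists>\<delta>>0. \<forall>x y. (x, y) \<in> A \<longrightarrow> dist x a < \<delta> \<longrightarrow> P (x, y))"
proof
  assume "eventually P (inf (filtercomap fst (nhds a)) (principal A))"
  then obtain Q where "eventually Q (nhds a)" and P: "\<And>p. Q (fst p) \<Longrightarrow> p \<in> A \<Longrightarrow> P p"
    unfolding eventually_inf_principal eventually_filtercomap by blast
  then obtain \<delta> where "0 < \<delta>" and Q: "\<And>x. dist x a < \<delta> \<Longrightarrow> Q x"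
    unfolding eventually_nhds_metric by blast
  then show "\<exists>\<delta>>0. \<forall>x y. (x, y) \<in> A \<longrightarrow> dist x a < \<delta> \<longrightarrow> P (x, y)"
    by (intro exI[of _ \<delta>] conjI allI impI P Q) auto
next
  assume "\<exists>\<delta>>0. \<forall>x y. (x, y) \<in> A \<longrightarrow> dist x a < \<delta> \<longrightarrow> P (x, y)"
  then obtain \<delta> where "0 < \<delta>" "\<forall>x y. (x, y) \<in> A \<longrightarrow> dist x a < \<delta> \<longrightarrow> P (x, y)"
    by blast
  then show "eventually P (inf (filtercomap fst (nhds a)) (principal A))"
    unfolding eventually_inf_principal eventually_filtercomap eventually_nhds_metric
    by (intro exI[of _ "\<lambda>x. dist x a < \<delta>"]) auto
qed

text \<open>The hypothesis \<open>0 < a\<close> makes all sides true for \<open>b = 0\<close>, where the quotient is \<open>\<infinity>\<close>.\<close>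

lemma
  assumes "0 < a" "0 \<le> b"
  shows ereal_le_divide_iff_mult: "ereal \<tau> \<le> ereal a / ereal b \<longleftrightarrow> \<tau> * b \<le> a"
    and ereal_less_divide_iff_mult: "ereal \<tau> < ereal a / ereal b \<longleftrightarrow> \<tau> * b < a"
proof -
  have "(ereal \<tau> \<le> ereal a / ereal b \<longleftrightarrow> \<tau> * b \<le> a) \<and> (ereal \<tau> < ereal a / ereal b \<longleftrightarrow> \<tau> * b < a)"
  proof (cases "b = 0")
    case True
    with assms have "ereal a / ereal b = \<infinity>" by simp
    with True assms show ?thesis by simp
  next
    case False
    with assms show ?thesis by (simp add: pos_le_divide_eq pos_less_divide_eq)
  qed
  then show "ereal \<tau> \<le> ereal a / ereal b \<longleftrightarrow> \<tau> * b \<le> a" "ereal \<tau> < ereal a / ereal b \<longleftrightarrow> \<tau> * b < a"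
    by blast+
qed

lemma dist_pos_if_notin_inv_map:
  assumes "y \<in> F x" "x \<notin> inv_map F ybar"
  shows "0 < dist y ybar"
  using assms by (auto simp: inv_map_def)

text \<open>Used contrapositively for the second part: if \<tau> exceeds the modulus, every ball
  around \<open>xbar\<close> contains a point at which the estimate fails.\<close>

lemma le_subreg_modulusI:
  assumes \<phi>: "admissible \<phi>" and "0 < \<delta>"
    and *: "\<And>x y. dist x xbar < \<delta> \<Longrightarrow> x \<notin> inv_map F ybar \<Longrightarrow> y \<in> F x \<Longrightarrow>
      \<tau> * infdist x (inv_map F ybar) \<le> \<phi> (dist y ybar)"
  shows "ereal \<tau> \<le> subreg_modulus \<phi> F xbar ybar"
  unfolding subreg_modulus_def
proof (rule Liminf_bounded, unfold eventually_filtercomap_fst_principal, intro exI[of _ \<delta>] conjI allI impI)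
  fix x y assume "(x, y) \<in> {(x, y). x \<notin> inv_map F ybar \<and> y \<in> F x}" "dist x xbar < \<delta>"
  then have xy: "dist x xbar < \<delta>" "x \<notin> inv_map F ybar" "y \<in> F x"
    by auto
  show "ereal \<tau> \<le> (case (x, y) of (x, y) \<Rightarrow>
      ereal (\<phi> (dist y ybar)) / ereal (infdist x (inv_map F ybar)))"
    using *[OF xy] admissible_pos[OF \<phi> dist_pos_if_notin_inv_map[OF xy(3,2)]]
    by (simp add: ereal_le_divide_iff_mult infdist_nonneg del: ereal_divide)
qed fact

lemma less_subreg_modulusD:
  assumes \<phi>: "admissible \<phi>" and "ereal \<tau> < subreg_modulus \<phi> F xbar ybar"
  obtains \<delta> where "0 < \<delta>" "\<And>x y. dist x xbar < \<delta> \<Longrightarrow> x \<notin> inv_map F ybar \<Longrightarrow> y \<in> F x \<Longrightarrow>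
      \<tau> * infdist x (inv_map F ybar) < \<phi> (dist y ybar)"
proof -
  from less_LiminfD[OF assms(2)[unfolded subreg_modulus_def]]
  obtain \<delta> where \<delta>: "0 < \<delta>" "\<And>x y. dist x xbar < \<delta> \<Longrightarrow> x \<notin> inv_map F ybar \<Longrightarrow> y \<in> F x \<Longrightarrow>
      ereal \<tau> < ereal (\<phi> (dist y ybar)) / ereal (infdist x (inv_map F ybar))"
    unfolding eventually_filtercomap_fst_principal by auto
  show thesis
  proof (rule that[OF \<delta>(1)])
    fix x y assume xy: "dist x xbar < \<delta>" "x \<notin> inv_map F ybar" "y \<in> F x"
    show "\<tau> * infdist x (inv_map F ybar) < \<phi> (dist y ybar)"
      using \<delta>(2)[OF xy] admissible_pos[OF \<phi> dist_pos_if_notin_inv_map[OF xy(3,2)]]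
      by (simp add: ereal_less_divide_iff_mult infdist_nonneg del: ereal_divide)
  qed
qed

lemma subreg_modulus_nonneg:
  assumes "admissible \<phi>"
  shows "0 \<le> subreg_modulus \<phi> F xbar ybar"
  using le_subreg_modulusI[OF assms, of 1 xbar F ybar 0] assms
  by (simp add: zero_ereal_def admissible_def)

section \<open>The metric \<open>dist_rho\<close> and the dependence of the slopes on \<rho>\<close>

lemma dist_rho_pos:
  assumes "0 < \<rho>" "p \<noteq> q"
  shows "0 < dist_rho \<rho> p q"
  using assms by (auto simp: dist_rho_def prod_eq_iff less_max_iff_disj)

lemma dist_rho_triangle:
  assumes "0 \<le> \<rho>"
  shows "dist_rho \<rho> p r \<le> dist_rho \<rho> p q + dist_rho \<rho> q r"
proof -
  have "\<rho> * dist (snd p) (snd r) \<le> \<rho> * dist (snd p) (snd q) + \<rho> * dist (snd q) (snd r)"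
    using mult_left_mono[OF dist_triangle assms] by (simp add: distrib_left)
  then show ?thesis
    using dist_triangle[of "fst p" "fst r" "fst q"] unfolding dist_rho_def by linarith
qed

text \<open>The product metric is at most the sum of the coordinate distances, and
  \<open>min 1 \<rho>\<close> times each of them is at most \<open>dist_rho\<close>. This supplies
  the constant \<open>c\<close> for Ekeland's principle.\<close>

lemma dist_rho_lower_bound:
  assumes "0 \<le> \<rho>"
  shows "min 1 \<rho> / 2 * dist p q \<le> dist_rho \<rho> p q"
proof -
  let ?m = "min 1 \<rho>" and ?a = "dist (fst p) (fst q)" and ?b = "dist (snd p) (snd q)"
  have "dist p q \<le> ?a + ?b"
    unfolding dist_prod_def by (rule sqrt_sum_squares_le_sum) auto
  then have "?m * dist p q \<le> ?m * ?a + ?m * ?b"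
    using assms by (metis distrib_left min_def mult_left_mono zero_le_one)
  moreover have "?m * ?a \<le> 1 * ?a" "?m * ?b \<le> \<rho> * ?b"
    by (intro mult_right_mono; simp)+
  ultimately show ?thesis
    unfolding dist_rho_def by linarith
qed

lemma le_nonlocal_slopeI:
  assumes "(u, v) \<in> gph F" "(u, v) \<noteq> (x, y)"
    and "\<tau> \<le> (\<phi> (dist y ybar) - \<phi> (dist v ybar)) / dist_rho \<rho> (u, v) (x, y)"
  shows "ereal \<tau> \<le> nonlocal_slope \<phi> \<rho> F ybar x y"
  unfolding nonlocal_slope_def
  by (rule SUP_upper2[of "(u, v)"]) (use assms in auto)

lemma nonlocal_slope_pos:
  assumes "admissible \<phi>" "(xbar, ybar) \<in> gph F" "0 < \<rho>" "y \<noteq> ybar"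
  shows "0 < nonlocal_slope \<phi> \<rho> F ybar x y"
proof -
  let ?q = "\<phi> (dist y ybar) / dist_rho \<rho> (xbar, ybar) (x, y)"
  have "0 < ?q"
    using assms by (intro divide_pos_pos admissible_pos[OF assms(1)] dist_rho_pos) auto
  then have "0 < ereal ?q" by simp
  also have "ereal ?q \<le> nonlocal_slope \<phi> \<rho> F ybar x y"
    using assms by (intro le_nonlocal_slopeI[of xbar ybar]) (auto simp: admissible_def)
  finally show ?thesis .
qed

text \<open>A larger \<rho> enlarges the denominators, which lowers the nonnegative quotients.
  Negative quotients may increase, but they stay below 0 and hence below the positive slope.\<close>

lemma nonlocal_slope_antimono:
  assumes "admissible \<phi>" "(xbar, ybar) \<in> gph F" "0 < \<rho>" "\<rho> \<le> \<rho>'" "y \<noteq> ybar"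
  shows "nonlocal_slope \<phi> \<rho>' F ybar x y \<le> nonlocal_slope \<phi> \<rho> F ybar x y"
  unfolding nonlocal_slope_def[of _ \<rho>']
proof (rule SUP_least, unfold split_paired_all mem_Collect_eq case_prod_conv)
  fix u v assume "(u, v) \<noteq> (x, y) \<and> (u, v) \<in> gph F"
  then have uv: "(u, v) \<in> gph F" "(u, v) \<noteq> (x, y)" by auto
  let ?a = "\<phi> (dist y ybar) - \<phi> (dist v ybar)"
  have pos: "0 < dist_rho \<rho> (u, v) (x, y)" "0 < dist_rho \<rho>' (u, v) (x, y)"
    using uv assms by (auto intro!: dist_rho_pos)
  show "ereal (?a / dist_rho \<rho>' (u, v) (x, y)) \<le> nonlocal_slope \<phi> \<rho> F ybar x y"
  proof (cases "0 \<le> ?a")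
    case True
    have "\<rho> * dist v y \<le> \<rho>' * dist v y"
      using assms(4) by (rule mult_right_mono) simp
    then have "dist_rho \<rho> (u, v) (x, y) \<le> dist_rho \<rho>' (u, v) (x, y)"
      by (auto simp: dist_rho_def)
    with True pos show ?thesis
      by (intro le_nonlocal_slopeI[OF uv] divide_left_mono) auto
  next
    case False
    with pos have "ereal (?a / dist_rho \<rho>' (u, v) (x, y)) \<le> 0"
      by (simp add: divide_nonpos_pos)
    also have "0 \<le> nonlocal_slope \<phi> \<rho> F ybar x y"
      using nonlocal_slope_pos assms by (metis less_imp_le)
    finally show ?thesis .
  qed
qed

text \<open>Increasing \<rho> lowers the infimum in two ways: more points compete, and each slope
  decreases.\<close>

lemma slope_inf_antimono:
  assumes "admissible \<phi>" "(xbar, ybar) \<in> gph F" "0 < \<rho>" "\<rho> \<le> \<rho>'"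
  shows "slope_inf \<phi> \<rho>' F xbar ybar \<le> slope_inf \<phi> \<rho> F xbar ybar"
  unfolding slope_inf_def
proof (rule INF_mono, clarify)
  fix x y assume xy: "(x, y) \<in> gph F" "dist x xbar < \<rho>" "dist y ybar < \<rho>" "x \<notin> inv_map F ybar"
  then have "y \<noteq> ybar" by (auto simp: gph_def inv_map_def)
  then have "nonlocal_slope \<phi> \<rho>' F ybar x y \<le> nonlocal_slope \<phi> \<rho> F ybar x y"
    using nonlocal_slope_antimono assms by blast
  with xy assms(4) show "\<exists>p\<in>{(x, y). (x, y) \<in> gph F \<and> dist x xbar < \<rho>' \<and> dist y ybar < \<rho>' \<and>
        x \<notin> inv_map F ybar}.
      (case p of (x, y) \<Rightarrow> nonlocal_slope \<phi> \<rho>' F ybar x y) \<le> nonlocal_slope \<phi> \<rho> F ybar x y"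
    by (intro bexI[of _ "(x, y)"]) auto
qed

text \<open>An antitone function of \<rho> > 0 converges to its supremum as \<rho> decreases to 0.
  This settles the existence of the limit behind \<open>Lim\<close>.\<close>

lemma uniform_strict_slope_eq_SUP:
  assumes "admissible \<phi>" "(xbar, ybar) \<in> gph F"
  shows "uniform_strict_slope \<phi> F xbar ybar = (SUP \<rho>\<in>{0<..}. slope_inf \<phi> \<rho> F xbar ybar)"
  unfolding uniform_strict_slope_def
proof (rule tendsto_Lim[OF trivial_limit_at_right_real order_tendstoI])
  let ?g = "\<lambda>\<rho>. slope_inf \<phi> \<rho> F xbar ybar"
  fix a assume "a < (SUP \<rho>\<in>{0<..}. ?g \<rho>)"
  then obtain r where r: "0 < r" "a < ?g r"
    by (auto simp: less_SUP_iff)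
  have "a < ?g \<rho>" if "0 < \<rho>" "\<rho> < r" for \<rho>
    using slope_inf_antimono[OF assms, of \<rho> r] that r by (auto intro: less_le_trans)
  with r(1) show "\<forall>\<^sub>F \<rho> in at_right 0. a < ?g \<rho>"
    unfolding eventually_at_right_field by blast
next
  let ?g = "\<lambda>\<rho>. slope_inf \<phi> \<rho> F xbar ybar"
  fix a assume a: "(SUP \<rho>\<in>{0<..}. ?g \<rho>) < a"
  have "?g \<rho> < a" if "0 < \<rho>" for \<rho>
    using that by (intro le_less_trans[OF SUP_upper a]) simp
  then show "\<forall>\<^sub>F \<rho> in at_right 0. ?g \<rho> < a"
    by (auto simp: eventually_at_filter)
qed

lemma uniform_strict_slope_nonneg:
  assumes "admissible \<phi>" "(xbar, ybar) \<in> gph F"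
  shows "0 \<le> uniform_strict_slope \<phi> F xbar ybar"
proof -
  have "0 \<le> slope_inf \<phi> 1 F xbar ybar"
    unfolding slope_inf_def
  proof (rule INF_greatest, clarify)
    fix x y assume "(x, y) \<in> gph F" "x \<notin> inv_map F ybar"
    then have "y \<noteq> ybar" by (auto simp: gph_def inv_map_def)
    then have "0 < nonlocal_slope \<phi> 1 F ybar x y"
      by (rule nonlocal_slope_pos[OF assms zero_less_one])
    then show "0 \<le> nonlocal_slope \<phi> 1 F ybar x y"
      by (rule less_imp_le)
  qed
  also have "\<dots> \<le> uniform_strict_slope \<phi> F xbar ybar"
    unfolding uniform_strict_slope_eq_SUP[OF assms] by (intro SUP_upper) simp
  finally show ?thesis .
qed

section \<open>The inequality in arbitrary metric spaces\<close>

lemma subreg_modulus_le_uniform_strict_slope: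
  fixes F :: "'a::metric_space \<Rightarrow> 'b::metric_space set"
  assumes gph: "(xbar, ybar) \<in> gph F" and \<phi>: "admissible \<phi>"
  shows "subreg_modulus \<phi> F xbar ybar \<le> uniform_strict_slope \<phi> F xbar ybar"
proof (rule ccontr)
  let ?S = "inv_map F ybar"
  assume "\<not> ?thesis"
  then obtain \<tau> where \<tau>: "uniform_strict_slope \<phi> F xbar ybar < ereal \<tau>"
    "ereal \<tau> < subreg_modulus \<phi> F xbar ybar"
    using ereal_dense2[of "uniform_strict_slope \<phi> F xbar ybar" "subreg_modulus \<phi> F xbar ybar"] by (auto simp: not_le)
  have "0 < ereal \<tau>"
    using uniform_strict_slope_nonneg[OF \<phi> gph] \<tau>(1) by (rule le_less_trans)
  then have "0 < \<tau>" by simp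
  obtain \<delta> where \<delta>: "0 < \<delta>" "\<And>x y. dist x xbar < \<delta> \<Longrightarrow> x \<notin> ?S \<Longrightarrow> y \<in> F x \<Longrightarrow>
      \<tau> * infdist x ?S < \<phi> (dist y ybar)"
    using less_subreg_modulusD[OF \<phi> \<tau>(2)] by metis
  obtain c r where c: "0 < c" "0 < r" "\<And>t. 0 < t \<Longrightarrow> t < r \<Longrightarrow> c * t < \<phi> t"
    using admissible_linear_lower_bound[OF \<phi>] by metis
  \<comment> \<open>The three bounds keep \<open>x\<close> where the subregularity estimate holds,
    keep \<open>dist y ybar\<close> where \<phi> dominates \<open>c * t\<close>, and make the term
    \<open>\<rho> * dist y ybar\<close> of \<open>dist_rho\<close> smaller than
    \<phi>(\<open>dist y ybar\<close>)/\<tau>.\<close>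
  define \<rho> where "\<rho> = min \<delta> (min r (c / \<tau>))"
  have \<rho>: "0 < \<rho>" "\<rho> \<le> \<delta>" "\<rho> \<le> r" "\<rho> \<le> c / \<tau>"
    using \<delta> c \<open>0 < \<tau>\<close> by (auto simp: \<rho>_def)
  have "ereal \<tau> \<le> slope_inf \<phi> \<rho> F xbar ybar"
    unfolding slope_inf_def
  proof (rule INF_greatest, clarify)
    fix x y assume xy: "(x, y) \<in> gph F" "dist x xbar < \<rho>" "dist y ybar < \<rho>" "x \<notin> ?S"
    let ?t = "dist y ybar"
    from xy have "y \<in> F x" by (simp add: gph_def)
    with xy have t: "0 < ?t" using dist_pos_if_notin_inv_map by metis
    have "\<tau> * infdist x ?S < \<phi> ?t"
      using xy \<rho> \<delta>(2) \<open>y \<in> F x\<close> by auto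
    then have "infdist x ?S < \<phi> ?t / \<tau>"
      using \<open>0 < \<tau>\<close> by (simp add: pos_less_divide_eq mult.commute)
    moreover have "?S \<noteq> {}"
      using gph by (auto simp: gph_def inv_map_def)
    \<comment> \<open>The distance to \<open>?S\<close> need not be attained, but the strict
      inequality leaves room for a near-minimizer.\<close>
    ultimately obtain u where u: "u \<in> ?S" "dist x u < \<phi> ?t / \<tau>"
      by (auto simp: infdist_def cINF_less_iff)
    have uF: "(u, ybar) \<in> gph F" and ne: "(u, ybar) \<noteq> (x, y)"
      using u xy by (auto simp: gph_def inv_map_def)
    have "\<tau> * \<rho> \<le> c"
      using \<rho>(4) \<open>0 < \<tau>\<close> by (simp add: pos_le_divide_eq mult.commute)
    then have "\<tau> * \<rho> * ?t \<le> c * ?t"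
      by (rule mult_right_mono) simp
    also have "\<dots> < \<phi> ?t"
      using c(3)[OF t] xy \<rho> by simp
    finally have "\<rho> * ?t < \<phi> ?t / \<tau>"
      using \<open>0 < \<tau>\<close> by (simp add: pos_less_divide_eq mult_ac)
    with u have "dist_rho \<rho> (u, ybar) (x, y) < \<phi> ?t / \<tau>"
      by (simp add: dist_rho_def dist_commute)
    then have "\<tau> \<le> \<phi> ?t / dist_rho \<rho> (u, ybar) (x, y)"
      using \<open>0 < \<tau>\<close> dist_rho_pos[OF \<rho>(1) ne]
      by (simp add: pos_less_divide_eq pos_le_divide_eq mult.commute)
    then show "ereal \<tau> \<le> nonlocal_slope \<phi> \<rho> F ybar x y"
      using \<phi> by (intro le_nonlocal_slopeI[OF uF ne]) (simp add: admissible_def)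
  qed
  also have "\<dots> \<le> uniform_strict_slope \<phi> F xbar ybar"
    unfolding uniform_strict_slope_eq_SUP[OF \<phi> gph] using \<rho>(1) by (intro SUP_upper) simp
  finally show False using \<tau>(1) by simp
qed

section \<open>The reverse inequality in complete spaces\<close>

lemma complete_Times_UNIV:
  assumes "complete (UNIV :: 'a::metric_space set)" "complete (UNIV :: 'b::metric_space set)"
  shows "complete (UNIV :: ('a \<times> 'b) set)"
  unfolding complete_def
proof (intro allI impI)
  fix s :: "nat \<Rightarrow> 'a \<times> 'b" assume "(\<forall>n. s n \<in> UNIV) \<and> Cauchy s"
  then have "Cauchy (\<lambda>n. fst (s n))" "Cauchy (\<lambda>n. snd (s n))"
    by (auto intro: Cauchy_fst Cauchy_snd)
  with assms obtain a b where "(\<lambda>n. fst (s n)) \<longlonglongrightarrow> a" "(\<lambda>n. snd (s n)) \<longlonglongrightarrow> b"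
    unfolding complete_def by (metis UNIV_I)
  from tendsto_Pair[OF this] show "\<exists>l\<in>UNIV. s \<longlonglongrightarrow> l"
    by auto
qed

text \<open>For \<tau> strictly between the two sides, Ekeland's principle on the closed piece
  \<open>gph F \<inter> U\<close> yields a point with slope at most \<tau> among those over which
  \<open>slope_inf\<close> is taken. The slope is nonlocal, so graph points outside \<open>U\<close>
  must be handled too; they are too far away to give a quotient above \<tau>.\<close>

lemma uniform_strict_slope_le_subreg_modulus:
  fixes F :: "'a::metric_space \<Rightarrow> 'b::metric_space set"
  assumes gph: "(xbar, ybar) \<in> gph F" and \<phi>: "admissible \<phi>"
    and compl: "complete (UNIV :: 'a set)" "complete (UNIV :: 'b set)"
    and "locally_closed_near (gph F) (xbar, ybar)"
  shows "uniform_strict_slope \<phi> F xbar ybar \<le> subreg_modulus \<phi> F xbar ybar"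
proof (rule ccontr)
  let ?S = "inv_map F ybar"
  assume "\<not> ?thesis"
  then obtain \<tau> where \<tau>: "subreg_modulus \<phi> F xbar ybar < ereal \<tau>"
    "ereal \<tau> < uniform_strict_slope \<phi> F xbar ybar"
    using ereal_dense2[of "subreg_modulus \<phi> F xbar ybar" "uniform_strict_slope \<phi> F xbar ybar"] by (auto simp: not_le)
  have "0 < ereal \<tau>"
    using subreg_modulus_nonneg[OF \<phi>] \<tau>(1) by (rule le_less_trans)
  then have "0 < \<tau>" by simp
  obtain \<rho> where \<rho>: "0 < \<rho>" "ereal \<tau> < slope_inf \<phi> \<rho> F xbar ybar"
    using \<tau>(2) unfolding uniform_strict_slope_eq_SUP[OF \<phi> gph] by (auto simp: less_SUP_iff)
  obtain U where U: "(xbar, ybar) \<in> interior U" "closed (gph F \<inter> U)"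
    using assms(5) unfolding locally_closed_near_def by blast
  then obtain e where e: "0 < e" "ball (xbar, ybar) e \<subseteq> U"
    by (meson mem_interior)
  have inU: "(u, v) \<in> U" if "dist u xbar < e / 2" "dist v ybar < e / 2" for u v
  proof -
    have "dist (xbar, ybar) (u, v) \<le> dist xbar u + dist ybar v"
      unfolding dist_Pair_Pair by (rule sqrt_sum_squares_le_sum) auto
    with that e(2) show ?thesis by (auto simp: dist_commute)
  qed
  \<comment> \<open>\<open>\<eta>\<close> is the radius within which the Ekeland point must stay,
    and \<open>m\<close> bounds from below its \<open>dist_rho\<close> to points outside
    \<open>U\<close>. In \<open>\<delta>\<close>, the bound \<open>\<eta> / 2\<close> allows for two
    moves (\<open>xbar\<close> to \<open>x\<close>, then \<open>x\<close> to \<open>a\<close>),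
    \<open>\<phi> \<eta> / \<tau>\<close> forces second coordinates within \<open>\<eta>\<close> of
    \<open>ybar\<close>, and \<open>m\<close> serves the competitors outside
    \<open>U\<close>.\<close>
  define \<eta> where "\<eta> = min \<rho> (e / 4)"
  define m where "m = min 1 \<rho> * (e / 4)"
  define \<delta> where "\<delta> = min (\<eta> / 2) (min (\<phi> \<eta> / \<tau>) m)"
  have "0 < \<eta>" "\<eta> \<le> \<rho>" "\<eta> \<le> e / 4" "0 < m"
    using \<rho> e by (auto simp: \<eta>_def m_def)
  have "0 < \<phi> \<eta>"
    using admissible_pos[OF \<phi> \<open>0 < \<eta>\<close>] .
  have "0 < \<delta>"
    using \<open>0 < \<eta>\<close> \<open>0 < m\<close> \<open>0 < \<tau>\<close> \<open>0 < \<phi> \<eta>\<close> by (simp add: \<delta>_def)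
  have "\<delta> \<le> \<eta> / 2" "\<delta> \<le> \<phi> \<eta> / \<tau>" "\<delta> \<le> m"
    unfolding \<delta>_def by linarith+
  then have \<tau>\<delta>: "\<tau> * \<delta> \<le> \<phi> \<eta>"
    using \<open>0 < \<tau>\<close> by (simp add: pos_le_divide_eq mult.commute)
  have lt_\<eta>: "t < \<eta>" if "0 \<le> t" "\<phi> t < \<phi> \<eta>" for t
    using that admissible_strict_mono[OF \<phi>, of \<eta> t] \<open>0 < \<eta>\<close> by (cases \<eta> t rule: linorder_cases) auto
  \<comment> \<open>The modulus does not restrict \<open>y\<close>; its closeness to
    \<open>ybar\<close> follows from \<open>small\<close>, since \<open>xbar\<close> in
    \<open>?S\<close> makes \<open>infdist x ?S\<close> less than \<open>\<delta>\<close> and \<phi>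
    is strictly increasing.\<close>
  obtain x y where xy: "dist x xbar < \<delta>" "x \<notin> ?S" "y \<in> F x"
    and small: "\<phi> (dist y ybar) < \<tau> * infdist x ?S"
    using le_subreg_modulusI[OF \<phi> \<open>0 < \<delta>\<close>, of xbar F ybar \<tau>] \<tau>(1) by (meson not_le)
  have "infdist x ?S \<le> dist x xbar"
    using gph by (intro infdist_le) (auto simp: gph_def inv_map_def)
  with xy(1) have D: "infdist x ?S < \<delta>" by simp
  then have "\<tau> * infdist x ?S < \<tau> * \<delta>"
    using \<open>0 < \<tau>\<close> by simp
  with small have y_small: "\<phi> (dist y ybar) < \<tau> * \<delta>" by simp
  define f where "f p = \<phi> (dist (snd p) ybar)" for p :: "'a \<times> 'b"
  define A where "A = gph F \<inter> U"
  have f_nonneg: "0 \<le> f p" for p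
    using \<phi> by (simp add: f_def admissible_def)
  have "dist y ybar < \<eta>"
    using lt_\<eta> y_small \<tau>\<delta> by simp
  then have "(x, y) \<in> A"
    using xy \<open>\<delta> \<le> \<eta> / 2\<close> \<open>\<eta> \<le> e / 4\<close> \<open>0 < \<eta>\<close> e(1) unfolding A_def
    by (auto simp: gph_def intro!: inU)
  have "complete A"
    using complete_closed_subset[of A UNIV] complete_Times_UNIV[OF compl] U(2)
    by (simp add: A_def)
  moreover have "continuous_on A f"
    unfolding f_def
    by (rule continuous_on_compose2[of "{0..}" \<phi>])
      (use \<phi> in \<open>auto simp: admissible_def intro!: continuous_intros\<close>)
  moreover have "\<tau> * dist_rho \<rho> p q \<le> \<tau> * dist_rho \<rho> p r + \<tau> * dist_rho \<rho> r q" for p q r :: "'a \<times> 'b"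
    using mult_left_mono[OF dist_rho_triangle, of \<rho> \<tau> p q r] \<open>0 < \<rho>\<close> \<open>0 < \<tau>\<close>
    by (simp add: distrib_left)
  moreover have "continuous_on A (\<lambda>p. \<tau> * dist_rho \<rho> p q)" for q
    unfolding dist_rho_def by (intro continuous_intros)
  moreover have "(\<tau> * (min 1 \<rho> / 2)) * dist p q \<le> \<tau> * dist_rho \<rho> p q" for p q :: "'a \<times> 'b"
    using mult_left_mono[OF dist_rho_lower_bound, of \<rho> \<tau> p q] \<open>0 < \<rho>\<close> \<open>0 < \<tau>\<close>
    by (simp add: mult.assoc)
  moreover have "0 < \<tau> * (min 1 \<rho> / 2)" "\<And>p :: 'a \<times> 'b. \<tau> * dist_rho \<rho> p p = 0"
    using \<open>0 < \<rho>\<close> \<open>0 < \<tau>\<close> by (auto simp: dist_rho_def)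
  ultimately obtain p where "p \<in> A" "f p + \<tau> * dist_rho \<rho> p (x, y) \<le> f (x, y)"
    "\<And>q. q \<in> A \<Longrightarrow> q \<noteq> p \<Longrightarrow> f p < f q + \<tau> * dist_rho \<rho> q p"
    using ekeland_variational_principle[of A "(x, y)" f 0 "\<lambda>p q. \<tau> * dist_rho \<rho> p q"
        "\<tau> * (min 1 \<rho> / 2)"] \<open>(x, y) \<in> A\<close> f_nonneg by metis
  then obtain a b where ab: "(a, b) \<in> A" "f (a, b) + \<tau> * dist_rho \<rho> (a, b) (x, y) \<le> f (x, y)"
    and min: "\<And>q. q \<in> A \<Longrightarrow> q \<noteq> (a, b) \<Longrightarrow> f (a, b) < f q + \<tau> * dist_rho \<rho> q (a, b)"
    by (cases p) auto
  \<comment> \<open>The total decrease of \<open>f\<close> is at most \<open>f (x, y)\<close>, so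
    the move from \<open>x\<close> to \<open>a\<close> is too short to reach
    \<open>?S\<close>.\<close>
  have "\<tau> * dist_rho \<rho> (a, b) (x, y) < \<tau> * infdist x ?S"
    using ab(2) small f_nonneg[of "(a, b)"] by (simp add: f_def)
  then have "dist_rho \<rho> (a, b) (x, y) < infdist x ?S"
    using \<open>0 < \<tau>\<close> by simp
  then have ax: "dist a x < infdist x ?S"
    by (simp add: dist_rho_def)
  then have "a \<notin> ?S"
    using infdist_le[of a ?S x] by (auto simp: dist_commute)
  have a_near: "dist a xbar < \<eta>"
    using dist_triangle[of a xbar x] ax D xy(1) \<open>\<delta> \<le> \<eta> / 2\<close> by simp
  have "0 \<le> \<tau> * dist_rho \<rho> (a, b) (x, y)"
    using \<open>0 < \<tau>\<close> by (simp add: dist_rho_def le_max_iff_disj)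
  with ab(2) have fab: "f (a, b) < \<tau> * \<delta>"
    using y_small by (simp add: f_def)
  then have b_near: "dist b ybar < \<eta>"
    using lt_\<eta> \<tau>\<delta> by (simp add: f_def)
  have "nonlocal_slope \<phi> \<rho> F ybar a b \<le> ereal \<tau>"
    unfolding nonlocal_slope_def
  proof (rule SUP_least, unfold split_paired_all mem_Collect_eq case_prod_conv)
    fix u v assume "(u, v) \<noteq> (a, b) \<and> (u, v) \<in> gph F"
    then have uv: "(u, v) \<in> gph F" "(u, v) \<noteq> (a, b)" by auto
    have "f (a, b) - f (u, v) \<le> \<tau> * dist_rho \<rho> (u, v) (a, b)"
    proof (cases "(u, v) \<in> U")
      case True
      with uv min[of "(u, v)"] show ?thesis by (simp add: A_def)
    next
      case False
      \<comment> \<open>Since \<open>(a, b)\<close> is within \<open>e / 4\<close> of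
        \<open>(xbar, ybar)\<close> in each coordinate, a point outside \<open>U\<close> is at
        \<open>dist_rho\<close> at least \<open>m\<close> from it. The decrease of \<open>f\<close>
        is at most \<open>f (a, b)\<close>, which is below \<tau> times \<open>\<delta>\<close> and
        hence below \<tau> times \<open>m\<close>.\<close>
      then have "e / 2 \<le> dist u xbar \<or> e / 2 \<le> dist v ybar"
        using inU not_le by blast
      then have "e / 4 \<le> dist u a \<or> e / 4 \<le> dist v b"
        using dist_triangle[of u xbar a] dist_triangle[of v ybar b] a_near b_near \<open>\<eta> \<le> e / 4\<close>
        by linarith
      moreover have "m \<le> 1 * (e / 4)" "m \<le> \<rho> * (e / 4)"
        unfolding m_def using e(1) by (intro mult_right_mono; simp)+
      ultimately have "m \<le> dist_rho \<rho> (u, v) (a, b)"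
        using mult_left_mono[of "e / 4" "dist v b" \<rho>] \<rho>(1)
        unfolding dist_rho_def fst_conv snd_conv by linarith
      with \<open>\<delta> \<le> m\<close> \<open>0 < \<tau>\<close> have "\<tau> * \<delta> \<le> \<tau> * dist_rho \<rho> (u, v) (a, b)"
        by simp
      with fab f_nonneg[of "(u, v)"] show ?thesis by simp
    qed
    then show "ereal ((\<phi> (dist b ybar) - \<phi> (dist v ybar)) / dist_rho \<rho> (u, v) (a, b)) \<le> ereal \<tau>"
      using dist_rho_pos[OF \<rho>(1) uv(2)] by (simp add: f_def pos_divide_le_eq)
  qed
  moreover have "slope_inf \<phi> \<rho> F xbar ybar \<le> nonlocal_slope \<phi> \<rho> F ybar a b"
    unfolding slope_inf_def using ab(1) a_near b_near \<open>\<eta> \<le> \<rho>\<close> \<open>a \<notin> ?S\<close>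
    by (intro INF_lower2[of "(a, b)"]) (auto simp: A_def)
  ultimately show False
    using \<rho>(2) by simp
qed

theorem theorem5p1:
  fixes F :: "'a::metric_space \<Rightarrow> 'b::metric_space set"
    and xbar :: 'a and ybar :: 'b and \<phi> :: "real \<Rightarrow> real"
  assumes "(xbar, ybar) \<in> gph F"
    and "admissible \<phi>"
  shows "subreg_modulus \<phi> F xbar ybar \<le> uniform_strict_slope \<phi> F xbar ybar \<and>
    (complete (UNIV :: 'a set) \<longrightarrow> complete (UNIV :: 'b set) \<longrightarrow>
      locally_closed_near (gph F) (xbar, ybar) \<longrightarrow>
      subreg_modulus \<phi> F xbar ybar = uniform_strict_slope \<phi> F xbar ybar)"
  using subreg_modulus_le_uniform_strict_slope[OF assms]
    uniform_strict_slope_le_subreg_modulus[OF assms] by (blast intro: antisym)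

end
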